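(* Let $Q=(q_{ij})_{1\le i,j\le N}$ be an irreducible transition rate matrix with steady-state distribution $\mu=(\mu_1,\dots,\mu_N)$, and let $\alpha$ be a real number with $\alpha\neq0,1$. There exists a constant $c_\alpha>0$, depending only on $\alpha$ and $Q$, such that for every solution $p(t)=(p_1(t),\dots,p_N(t))$ of the master equation $\frac{dp}{dt}=pQ$ starting from a probability distribution $p(0)$, and every $t\ge0$ at which all components of $p(t)$ are positive (in particular every $t>0$), writing $p_i=p_i(t)$, the Tsallis-type free energy $$F_\alpha = \frac{1}{\alpha(\alpha-1)}\Big[\sum_ip_i\Big(\frac{p_i}{\mu_i}\Big)^{\alpha-1}-1\Big]$$ satisfies $$-\frac{dF_{\alpha}}{dt} \;\ge\; \begin{cases} c_\alpha \displaystyle\sum_i\Big[\sum_{j\neq i}(p_jq_{ji}-p_iq_{ij})\Big]^2, &\text{if } \alpha<2, \\[2mm] c_\alpha \displaystyle\sum_i\Big|\sum_{j\neq i}(p_jq_{ji}-p_iq_{ij})\Big|^\alpha, &\text{if } \alpha\geq 2. \end{cases}$$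
   Context: Transition rate matrix on the finite state space $\{1,\dots,N\}$: a real matrix $Q=(q_{ij})$ with $q_{ij}\ge 0$ for $i\ne j$ and $q_{ii}=-\sum_{j\ne i}q_{ij}$. Irreducible: for each pair of states $i\neq j$ there is a sequence of states $i_1=i,i_2,\dots,i_m=j$ with $q_{i_1i_2}q_{i_2i_3}\cdots q_{i_{m-1}i_m}>0$. Under irreducibility there is a unique probability distribution $\mu$ with $\mu Q=0$ (the steady-state distribution), and all its components are positive. For any initial probability distribution $p(0)$, the solution $p(t)$ (a row vector) of $dp/dt=pQ$ is a probability distribution for all $t\ge 0$, and all its components are positive for $t>0$. The derivative $dF_\alpha/dt$ is along the solution $p(t)$ (one-sided at $t=0$). *)

theory Defs
  imports "HOL-Analysis.Analysis"
begin

text \<open>The states are the elements of a finite type \<open>'n\<close>, so \<open>N = CARD('n)\<close>;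
  the rate \<open>q\<^sub>i\<^sub>j\<close> is \<open>Q $ i $ j\<close>.\<close>

definition transition_rate_matrix :: "real ^ 'n ^ 'n \<Rightarrow> bool" where
  "transition_rate_matrix Q \<longleftrightarrow>
     (\<forall>i j. i \<noteq> j \<longrightarrow> 0 \<le> Q $ i $ j) \<and>
     (\<forall>i. Q $ i $ i = - (\<Sum>j\<in>UNIV - {i}. Q $ i $ j))"

definition irreducible_rates :: "real ^ 'n ^ 'n \<Rightarrow> bool" where
  "irreducible_rates Q \<longleftrightarrow>
     (\<forall>i j. i \<noteq> j \<longrightarrow>
        (\<exists>xs. xs \<noteq> [] \<and> hd xs = i \<and> last xs = j \<and>
              (\<Prod>k<length xs - 1. Q $ (xs ! k) $ (xs ! Suc k)) > 0))"

definition prob_distribution :: "real ^ 'n \<Rightarrow> bool" where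
  "prob_distribution p \<longleftrightarrow> (\<forall>i. 0 \<le> p $ i) \<and> (\<Sum>i\<in>UNIV. p $ i) = 1"

definition steady_state :: "real ^ 'n ^ 'n \<Rightarrow> real ^ 'n \<Rightarrow> bool" where
  "steady_state Q \<mu> \<longleftrightarrow> prob_distribution \<mu> \<and> \<mu> v* Q = 0"

text \<open>Solutions live on \<open>[0, \<infinity>)\<close>, with the one-sided derivative at \<open>0\<close>.\<close>

definition solves_master_equation :: "real ^ 'n ^ 'n \<Rightarrow> (real \<Rightarrow> real ^ 'n) \<Rightarrow> bool" where
  "solves_master_equation Q p \<longleftrightarrow>
     (\<forall>t\<ge>0. (p has_vector_derivative p t v* Q) (at t within {0..}))"

definition tsallis_free_energy :: "real \<Rightarrow> real ^ 'n \<Rightarrow> real ^ 'n \<Rightarrow> real" where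
  "tsallis_free_energy \<alpha> \<mu> p =
     1 / (\<alpha> * (\<alpha> - 1)) * ((\<Sum>i\<in>UNIV. p $ i * (p $ i / \<mu> $ i) powr (\<alpha> - 1)) - 1)"

definition net_flux :: "real ^ 'n ^ 'n \<Rightarrow> real ^ 'n \<Rightarrow> 'n \<Rightarrow> real" where
  "net_flux Q p i = (\<Sum>j\<in>UNIV - {i}. p $ j * Q $ j $ i - p $ i * Q $ i $ j)"

end

theory Submission
  imports Defs
begin

text \<open>Write \<open>x\<^sub>i = p\<^sub>i / \<mu>\<^sub>i\<close> and \<open>\<phi> x = x\<^sup>\<alpha> / (\<alpha> (\<alpha> - 1))\<close>, so \<open>\<phi>'' x = x powr (\<alpha> - 2)\<close>.
  Because the rows of \<open>Q\<close> sum to zero and \<open>\<mu> Q = 0\<close>, the dissipation \<open>- dF/dt\<close> equals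
  \<open>\<Sum>\<^sub>i \<Sum>\<^sub>j \<mu>\<^sub>j q\<^sub>j\<^sub>i B(x\<^sub>j, x\<^sub>i)\<close>, where
  \<open>B(y, x) = \<phi> y - \<phi> x - \<phi>' x (y - x)\<close> is the Bregman divergence of \<open>\<phi>\<close>.
  The \<open>x\<^sub>i\<close> are bounded by \<open>M = \<Sum>\<^sub>i 1 / \<mu>\<^sub>i\<close>; hence \<open>B(y, x)\<close> dominates \<open>\<bar>y - x\<bar>\<^sup>2\<close> if \<open>\<alpha> < 2\<close>
  (there \<open>\<phi>'' \<ge> M powr (\<alpha> - 2)\<close>), and it dominates \<open>\<bar>y - x\<bar>\<^sup>\<alpha>\<close> if \<open>\<alpha> \<ge> 2\<close> because \<open>z powr (\<alpha> - 1)\<close>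
  is superadditive. The net flux into \<open>i\<close> is \<open>\<Sum>\<^sub>j \<mu>\<^sub>j q\<^sub>j\<^sub>i (x\<^sub>j - x\<^sub>i)\<close>, so its power is in turn
  bounded by the same weighted sum of \<open>\<bar>x\<^sub>j - x\<^sub>i\<bar>\<^sup>2\<close> or \<open>\<bar>x\<^sub>j - x\<^sub>i\<bar>\<^sup>\<alpha>\<close>.\<close>

section \<open>Real inequalities\<close>

text \<open>Splitting off one factor, \<open>x powr s = x * x powr (s - 1)\<close>, leaves a
  nonnegative exponent, so both remaining powers are at most
  \<open>(a + b) powr (s - 1)\<close>.\<close>

lemma powr_superadditive:
  fixes a b s :: real
  assumes "0 \<le> a" "0 \<le> b" "1 \<le> s"
  shows "a powr s + b powr s \<le> (a + b) powr s"
proof -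
  have *: "x powr s = x * x powr (s - 1)" if "0 \<le> x" for x :: real
    using powr_mult_base[OF that, of "s - 1"] by simp
  have "a * a powr (s - 1) + b * b powr (s - 1) \<le> a * (a + b) powr (s - 1) + b * (a + b) powr (s - 1)"
    using assms by (intro add_mono mult_left_mono powr_mono2) auto
  then show ?thesis
    using assms by (simp add: * distrib_right)
qed

text \<open>Moving away from \<open>x\<close> never decreases \<open>g\<close>, on whichever side
  \<open>y\<close> lies, so one sign condition serves both orderings. The base point is excluded
  because \<open>\<bar>z - x\<bar> powr \<alpha>\<close> is differentiated below only for
  \<open>z \<noteq> x\<close>.\<close>

lemma nonneg_if_derivative_pushes_away:
  fixes g g' :: "real \<Rightarrow> real"
  assumes cont: "continuous_on (closed_segment x y) g"
    and "0 \<le> g x"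
    and deriv: "\<And>z. z \<in> open_segment x y \<Longrightarrow> (g has_real_derivative g' z) (at z)"
    and sign: "\<And>z. z \<in> open_segment x y \<Longrightarrow> 0 \<le> g' z * (z - x)"
  shows "0 \<le> g y"
proof (cases "x \<le> y")
  case True
  have "g x \<le> g y"
  proof (rule DERIV_nonneg_imp_increasing_open[OF True])
    fix z assume z: "x < z" "z < y"
    then have "z \<in> open_segment x y"
      by (simp add: open_segment_eq_real_ivl)
    then show "\<exists>d. (g has_real_derivative d) (at z) \<and> 0 \<le> d"
      using deriv sign z by (metis diff_gt_0_iff_gt zero_le_mult_iff not_less)
  next
    show "continuous_on {x..y} g"
      using cont True by (simp add: closed_segment_eq_real_ivl)
  qed
  then show ?thesis using \<open>0 \<le> g x\<close> by simp
next
  case False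
  then have yx: "y \<le> x" by simp
  have "g x \<le> g y"
  proof (rule DERIV_nonpos_imp_decreasing_open[OF yx])
    fix z assume z: "y < z" "z < x"
    then have "z \<in> open_segment x y"
      by (simp add: open_segment_eq_real_ivl)
    then show "\<exists>d. (g has_real_derivative d) (at z) \<and> d \<le> 0"
      using deriv sign z by (metis diff_less_0_iff_less zero_le_mult_iff not_less)
  next
    show "continuous_on {y..x} g"
      using cont False by (simp add: closed_segment_eq_real_ivl)
  qed
  then show ?thesis using \<open>0 \<le> g x\<close> by simp
qed

lemma powr_potential_derivative:
  fixes z \<alpha> :: real
  assumes "0 < z" "\<alpha> \<noteq> 0"
  shows "((\<lambda>z. z powr \<alpha> / (\<alpha> * (\<alpha> - 1))) has_real_derivative z powr (\<alpha> - 1) / (\<alpha> - 1)) (at z)"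
  using DERIV_cdivide[OF has_real_derivative_powr[OF assms(1), of \<alpha>], of "\<alpha> * (\<alpha> - 1)"] assms(2)
  by simp

text \<open>For \<open>\<alpha> < 2\<close> the second derivative
  \<open>z powr (\<alpha> - 2)\<close> is decreasing, hence at least
  \<open>M powr (\<alpha> - 2)\<close> up to \<open>M\<close>. Subtracting a quadratic with this
  curvature leaves a convex function.\<close>

lemma powr_bregman_ge_square:
  fixes \<alpha> M x y :: real
  assumes "\<alpha> \<noteq> 0" "\<alpha> \<noteq> 1" "\<alpha> < 2" and x: "0 < x" "x \<le> M" and y: "0 < y" "y \<le> M"
  shows "M powr (\<alpha> - 2) / 2 * (y - x)\<^sup>2 \<le> y powr \<alpha> / (\<alpha> * (\<alpha> - 1)) - x powr \<alpha> / (\<alpha> * (\<alpha> - 1))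
           - x powr (\<alpha> - 1) / (\<alpha> - 1) * (y - x)"
proof -
  define L where "L = M powr (\<alpha> - 2)"
  \<comment> \<open>\<open>h\<close> is the derivative of the potential minus
    \<open>L / 2 * z\<^sup>2\<close>; its monotonicity is the convexity that is used.\<close>
  define h where "h z = z powr (\<alpha> - 1) / (\<alpha> - 1) - L * z" for z
  have h_mono: "h a \<le> h b" if "0 < a" "a \<le> b" "b \<le> M" for a b
  proof (rule DERIV_nonneg_imp_nondecreasing[OF \<open>a \<le> b\<close>])
    fix z assume z: "a \<le> z" "z \<le> b"
    have "(h has_real_derivative z powr (\<alpha> - 2) - L) (at z)"
      unfolding h_def using z that \<open>\<alpha> \<noteq> 1\<close>
      by (auto intro!: derivative_eq_intros)
    moreover have "L \<le> z powr (\<alpha> - 2)"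
      unfolding L_def using z that \<open>\<alpha> < 2\<close> by (intro powr_mono2') auto
    ultimately show "\<exists>d. (h has_real_derivative d) (at z) \<and> 0 \<le> d"
      by force
  qed
  define g where "g z = z powr \<alpha> / (\<alpha> * (\<alpha> - 1)) - x powr \<alpha> / (\<alpha> * (\<alpha> - 1))
           - x powr (\<alpha> - 1) / (\<alpha> - 1) * (z - x) - L / 2 * (z - x)\<^sup>2" for z
  have seg: "0 < z \<and> z \<le> M" if "z \<in> closed_segment x y" for z
    using that x y by (auto simp: closed_segment_eq_real_ivl split: if_splits)
  have deriv: "(g has_real_derivative h z - h x) (at z)" if "z \<in> closed_segment x y" for z
  proof -
    have "0 < z" using seg[OF that] by simp
    have "((\<lambda>z. a * (z - x)) has_real_derivative a) (at z)"
      "((\<lambda>z. L / 2 * (z - x)\<^sup>2) has_real_derivative L * (z - x)) (at z)" for a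
      by (auto intro!: derivative_eq_intros)
    then have "(g has_real_derivative
        z powr (\<alpha> - 1) / (\<alpha> - 1) - 0 - x powr (\<alpha> - 1) / (\<alpha> - 1) - L * (z - x)) (at z)"
      unfolding g_def
      by (intro DERIV_diff DERIV_const powr_potential_derivative[OF \<open>0 < z\<close> \<open>\<alpha> \<noteq> 0\<close>])
    then show ?thesis
      by (simp add: h_def algebra_simps)
  qed
  have "0 \<le> g y"
  proof (rule nonneg_if_derivative_pushes_away[where x = x and g = g and g' = "\<lambda>z. h z - h x"])
    show "continuous_on (closed_segment x y) g"
      by (rule DERIV_continuous_on[OF has_field_derivative_at_within[OF deriv]])
    show "0 \<le> g x"
      by (simp add: g_def)
    fix z assume "z \<in> open_segment x y"
    then have z: "z \<in> closed_segment x y"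
      using open_closed_segment by blast
    show "(g has_real_derivative h z - h x) (at z)"
      using deriv z by blast
    show "0 \<le> (h z - h x) * (z - x)"
      using h_mono[of x z] h_mono[of z x] seg[OF z] x
      by (cases "x \<le> z") (auto simp: zero_le_mult_iff)
  qed
  then show ?thesis
    by (simp add: g_def L_def)
qed

text \<open>The gap between the two sides vanishes at \<open>y = x\<close>. Its derivative in
  \<open>y\<close>, times \<open>y - x\<close>, is nonnegative by superadditivity of the power with
  exponent \<open>\<alpha> - 1 \<ge> 1\<close>.\<close>

lemma powr_bregman_ge_powr:
  fixes \<alpha> x y :: real
  assumes "2 \<le> \<alpha>" and x: "0 < x" and y: "0 < y"
  shows "1 / (\<alpha> * (\<alpha> - 1)) * \<bar>y - x\<bar> powr \<alpha>
    \<le> y powr \<alpha> / (\<alpha> * (\<alpha> - 1)) - x powr \<alpha> / (\<alpha> * (\<alpha> - 1)) - x powr (\<alpha> - 1) / (\<alpha> - 1) * (y - x)"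
proof -
  define g where "g z = z powr \<alpha> / (\<alpha> * (\<alpha> - 1)) - x powr \<alpha> / (\<alpha> * (\<alpha> - 1))
           - x powr (\<alpha> - 1) / (\<alpha> - 1) * (z - x) - 1 / (\<alpha> * (\<alpha> - 1)) * \<bar>z - x\<bar> powr \<alpha>" for z
  define g' where "g' z = (z powr (\<alpha> - 1) - x powr (\<alpha> - 1) - sgn (z - x) * \<bar>z - x\<bar> powr (\<alpha> - 1)) / (\<alpha> - 1)" for z
  have nz: "\<alpha> \<noteq> 0" "\<alpha> - 1 \<noteq> 0" "\<alpha> \<noteq> 1" using assms by auto
  have seg: "0 < z" if "z \<in> closed_segment x y" for z
    using that x y by (auto simp: closed_segment_eq_real_ivl split: if_splits)
  have "0 \<le> g y"
  proof (rule nonneg_if_derivative_pushes_away[where x = x and g = g and g' = g'])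
    have "continuous_on (closed_segment x y) (\<lambda>z. z powr \<alpha>)"
      using seg assms(1) by (intro continuous_on_powr' continuous_on_id continuous_on_const) force
    moreover have "continuous_on (closed_segment x y) (\<lambda>z. \<bar>z - x\<bar> powr \<alpha>)"
      using assms(1)
      by (intro continuous_on_powr' continuous_on_rabs continuous_on_diff continuous_on_id
          continuous_on_const) simp
    ultimately show "continuous_on (closed_segment x y) g"
      unfolding g_def using nz
      by (intro continuous_on_diff continuous_on_divide continuous_on_mult continuous_on_const
          continuous_on_id) auto
    show "0 \<le> g x"
      by (simp add: g_def)
    fix z assume "z \<in> open_segment x y"
    then have z: "z \<in> closed_segment x y" "z \<noteq> x"
      using open_closed_segment by (auto simp: open_segment_def)
    then have "0 < z" using seg by blast
    have abs: "((\<lambda>z. \<bar>z - x\<bar>) has_real_derivative sgn (z - x)) (at z)"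
    proof (cases "x < z")
      case True
      have "((\<lambda>z. z - x) has_real_derivative 1) (at z)"
        by (auto intro!: derivative_eq_intros)
      from has_field_derivative_transform_within_open[OF this, of "{x<..}" "\<lambda>z. \<bar>z - x\<bar>"]
      show ?thesis using True by simp
    next
      case False
      have "((\<lambda>z. x - z) has_real_derivative - 1) (at z)"
        by (auto intro!: derivative_eq_intros)
      from has_field_derivative_transform_within_open[OF this, of "{..<x}" "\<lambda>z. \<bar>z - x\<bar>"]
      show ?thesis using False \<open>z \<noteq> x\<close> by simp
    qed
    have "((\<lambda>z. \<bar>z - x\<bar> powr \<alpha>) has_real_derivative
        \<alpha> * \<bar>z - x\<bar> powr (\<alpha> - 1) * sgn (z - x)) (at z)"
      using \<open>z \<noteq> x\<close> by (intro DERIV_chain2[OF has_real_derivative_powr abs]) auto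
    from DERIV_cmult[OF this, of "1 / (\<alpha> * (\<alpha> - 1))"]
    have "((\<lambda>z. 1 / (\<alpha> * (\<alpha> - 1)) * \<bar>z - x\<bar> powr \<alpha>) has_real_derivative
        sgn (z - x) * \<bar>z - x\<bar> powr (\<alpha> - 1) / (\<alpha> - 1)) (at z)"
      using nz by (simp add: mult.commute)
    moreover have "((\<lambda>z. a * (z - x)) has_real_derivative a) (at z)" for a
      by (auto intro!: derivative_eq_intros)
    ultimately have "(g has_real_derivative z powr (\<alpha> - 1) / (\<alpha> - 1) - 0 - x powr (\<alpha> - 1) / (\<alpha> - 1)
        - sgn (z - x) * \<bar>z - x\<bar> powr (\<alpha> - 1) / (\<alpha> - 1)) (at z)"
      unfolding g_def
      by (intro DERIV_diff DERIV_const powr_potential_derivative[OF \<open>0 < z\<close> nz(1)])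
    then show "(g has_real_derivative g' z) (at z)"
      by (simp add: g'_def diff_divide_distrib)
    show "0 \<le> g' z * (z - x)"
    proof (cases "x < z")
      case True
      then have "x powr (\<alpha> - 1) + (z - x) powr (\<alpha> - 1) \<le> z powr (\<alpha> - 1)"
        using powr_superadditive[of x "z - x" "\<alpha> - 1"] assms by simp
      then show ?thesis
        using True assms by (simp add: g'_def)
    next
      case False
      then have "z powr (\<alpha> - 1) + (x - z) powr (\<alpha> - 1) \<le> x powr (\<alpha> - 1)"
        using powr_superadditive[of z "x - z" "\<alpha> - 1"] assms \<open>0 < z\<close> by simp
      then have "g' z \<le> 0"
        using False \<open>z \<noteq> x\<close> assms by (simp add: g'_def divide_le_0_iff abs_if)
      then show ?thesis
        using False by (simp add: mult_nonpos_nonpos)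
    qed
  qed
  then show ?thesis
    by (simp add: g_def)
qed

text \<open>A crude power mean inequality:
  \<open>w j powr \<beta> \<le> w j * W powr (\<beta> - 1)\<close> bounds each of the
  \<open>card A\<close> terms by \<open>S powr (1 / \<beta>)\<close>. The weights stay to the first
  power on the right, as they occur in the dissipation.\<close>

lemma weighted_sum_powr_le:
  fixes w d :: "'a \<Rightarrow> real"
  assumes "finite A" "1 \<le> \<beta>" and w: "\<And>j. j \<in> A \<Longrightarrow> 0 \<le> w j \<and> w j \<le> W" and "0 < W"
  shows "\<bar>\<Sum>j\<in>A. w j * d j\<bar> powr \<beta>
    \<le> real (card A) powr \<beta> * W powr (\<beta> - 1) * (\<Sum>j\<in>A. w j * \<bar>d j\<bar> powr \<beta>)"
proof -
  define S where "S = W powr (\<beta> - 1) * (\<Sum>j\<in>A. w j * \<bar>d j\<bar> powr \<beta>)"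
  have "0 \<le> S"
    unfolding S_def using w by (intro mult_nonneg_nonneg sum_nonneg) auto
  have le: "w j * \<bar>d j\<bar> \<le> S powr (1 / \<beta>)" if j: "j \<in> A" for j
  proof -
    have "(w j * \<bar>d j\<bar>) powr \<beta> = (w j * w j powr (\<beta> - 1)) * \<bar>d j\<bar> powr \<beta>"
      using w[OF j] powr_mult_base[of "w j" "\<beta> - 1"] by (simp add: powr_mult)
    also have "\<dots> \<le> (w j * W powr (\<beta> - 1)) * \<bar>d j\<bar> powr \<beta>"
      using w[OF j] assms(2) by (intro mult_right_mono mult_left_mono powr_mono2) auto
    also have "\<dots> = W powr (\<beta> - 1) * (w j * \<bar>d j\<bar> powr \<beta>)"
      by simp
    also have "\<dots> \<le> S"
      unfolding S_def using w j \<open>finite A\<close>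
      by (intro mult_left_mono member_le_sum[of j A "\<lambda>j. w j * \<bar>d j\<bar> powr \<beta>"]) auto
    finally have "((w j * \<bar>d j\<bar>) powr \<beta>) powr (1 / \<beta>) \<le> S powr (1 / \<beta>)"
      using assms(2) by (intro powr_mono2) auto
    then show ?thesis
      using w[OF j] assms(2) by (simp add: powr_powr)
  qed
  have "\<bar>\<Sum>j\<in>A. w j * d j\<bar> \<le> (\<Sum>j\<in>A. w j * \<bar>d j\<bar>)"
    using w by (intro order.trans[OF sum_abs] sum_mono) (simp add: abs_mult)
  also have "\<dots> \<le> real (card A) * S powr (1 / \<beta>)"
    using le by (intro sum_bounded_above)
  finally have "\<bar>\<Sum>j\<in>A. w j * d j\<bar> powr \<beta> \<le> (real (card A) * S powr (1 / \<beta>)) powr \<beta>"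
    using assms(2) by (intro powr_mono2) auto
  also have "\<dots> = real (card A) powr \<beta> * S"
    using assms(2) \<open>0 \<le> S\<close> by (simp add: powr_mult powr_powr)
  finally show ?thesis
    by (simp add: S_def mult.assoc)
qed

text \<open>The first-order error is at most \<open>(y - x)\<^sup>2\<close>, also across the kink of
  \<open>min x 0\<close>. This makes the squared negative part of a solution differentiable.\<close>

lemma has_real_derivative_min_0_square:
  fixes x :: real
  shows "((\<lambda>x. (min x 0)\<^sup>2) has_real_derivative 2 * min x 0) (at x)"
proof -
  have quad: "\<bar>(min y 0)\<^sup>2 - (min x 0)\<^sup>2 - 2 * min x 0 * (y - x)\<bar> \<le> (y - x)\<^sup>2" for y
  proof (cases "x \<le> 0"; cases "y \<le> 0")
    assume "x \<le> 0" "\<not> y \<le> 0"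
    then have "x * y \<le> 0" by (simp add: mult_nonpos_nonneg)
    moreover have "(min y 0)\<^sup>2 - (min x 0)\<^sup>2 - 2 * min x 0 * (y - x) = x\<^sup>2 - 2 * (x * y)"
      using \<open>x \<le> 0\<close> \<open>\<not> y \<le> 0\<close> by (simp add: min_def power2_eq_square algebra_simps)
    moreover have "(y - x)\<^sup>2 = y\<^sup>2 + (x\<^sup>2 - 2 * (x * y))"
      by (simp add: power2_eq_square algebra_simps)
    moreover have "0 \<le> x\<^sup>2 - 2 * (x * y)"
      using \<open>x * y \<le> 0\<close> zero_le_power2[of x] by linarith
    ultimately show ?thesis
      by (simp add: abs_of_nonneg)
  next
    assume "\<not> x \<le> 0" "y \<le> 0"
    then have "x * y \<le> 0" by (simp add: mult_nonneg_nonpos)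
    then show ?thesis
      using \<open>\<not> x \<le> 0\<close> \<open>y \<le> 0\<close> by (simp add: min_def power2_eq_square algebra_simps)
  next
    assume "x \<le> 0" "y \<le> 0"
    then have "(min y 0)\<^sup>2 - (min x 0)\<^sup>2 - 2 * min x 0 * (y - x) = (y - x)\<^sup>2"
      by (simp add: min_def power2_eq_square algebra_simps)
    then show ?thesis by simp
  qed simp
  have quot: "\<bar>((min y 0)\<^sup>2 - (min x 0)\<^sup>2) / (y - x) - 2 * min x 0\<bar> \<le> \<bar>y - x\<bar>" if "y \<noteq> x" for y
  proof -
    have "((min y 0)\<^sup>2 - (min x 0)\<^sup>2) / (y - x) - 2 * min x 0
        = ((min y 0)\<^sup>2 - (min x 0)\<^sup>2 - 2 * min x 0 * (y - x)) / (y - x)"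
      using that by (simp add: divide_simps)
    moreover have "\<bar>(min y 0)\<^sup>2 - (min x 0)\<^sup>2 - 2 * min x 0 * (y - x)\<bar> \<le> \<bar>y - x\<bar> * \<bar>y - x\<bar>"
      using quad[of y] by (simp add: power2_eq_square)
    ultimately show ?thesis
      using that by (simp add: pos_divide_le_eq)
  qed
  have "((\<lambda>y. ((min y 0)\<^sup>2 - (min x 0)\<^sup>2) / (y - x) - 2 * min x 0) \<longlongrightarrow> 0) (at x)"
  proof (rule Lim_null_comparison[where g = "\<lambda>y. \<bar>y - x\<bar>", rotated])
    show "((\<lambda>y. \<bar>y - x\<bar>) \<longlongrightarrow> 0) (at x)"
      by (simp add: tendsto_rabs_zero_iff LIM_zero)
  qed (simp add: eventually_at_filter quot)
  then show ?thesis
    by (simp add: has_field_derivative_iff LIM_zero_iff)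
qed

section \<open>Transition rate matrices\<close>

lemma vector_matrix_mult_nth: "(v v* A) $ i = (\<Sum>j\<in>UNIV. v $ j * A $ j $ i)"
  by (simp add: vector_matrix_mult_def mult.commute)

lemma transition_rate_matrix_row_sum:
  assumes "transition_rate_matrix Q"
  shows "(\<Sum>j\<in>UNIV. Q $ i $ j) = 0"
  using assms sum.remove[of UNIV i "\<lambda>j. Q $ i $ j"] by (simp add: transition_rate_matrix_def)

text \<open>The diagonal rate is minus the total exit rate, so the loss terms form the diagonal term
  of the product.\<close>

lemma net_flux_eq:
  assumes "transition_rate_matrix Q"
  shows "net_flux Q p i = (p v* Q) $ i"
proof -
  have "Q $ i $ i = - (\<Sum>j\<in>UNIV - {i}. Q $ i $ j)"
    using assms by (simp add: transition_rate_matrix_def)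
  then show ?thesis
    by (simp add: net_flux_def vector_matrix_mult_nth sum_subtractf sum_distrib_left
        sum.remove[of UNIV i "\<lambda>j. p $ j * Q $ j $ i"])
qed

text \<open>Induction along a connecting path; it serves to spread positivity from one state to all,
  for \<open>\<mu>\<close> and for \<open>p t\<close>.\<close>

lemma irreducible_rates_induct:
  assumes "transition_rate_matrix Q" "irreducible_rates Q" and start: "P i"
    and step: "\<And>j k. j \<noteq> k \<Longrightarrow> 0 < Q $ j $ k \<Longrightarrow> P j \<Longrightarrow> P k"
  shows "P j"
proof (cases "i = j")
  case False
  then obtain xs where xs: "xs \<noteq> []" "hd xs = i" "last xs = j"
    and prod: "(\<Prod>k<length xs - 1. Q $ (xs ! k) $ (xs ! Suc k)) > 0"
    using assms(2) unfolding irreducible_rates_def by blast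
  have "P (xs ! k)" if "k < length xs" for k
    using that
  proof (induction k)
    case 0
    then show ?case using xs start by (simp add: hd_conv_nth)
  next
    case (Suc k)
    then have "k \<in> {..<length xs - 1}" by simp
    \<comment> \<open>A path may repeat a state, and negative diagonal factors may cancel in pairs,
      so only nonvanishing of each factor is extracted. Off the diagonal this means positivity; a
      repeated state inherits \<open>P\<close> trivially.\<close>
    then have "Q $ (xs ! k) $ (xs ! Suc k) \<noteq> 0"
      using prod by (metis (no_types, lifting) finite_lessThan less_irrefl prod_zero_iff)
    then show ?case
      using Suc step[of "xs ! k" "xs ! Suc k"] assms(1)
      by (cases "xs ! k = xs ! Suc k") (auto simp: transition_rate_matrix_def less_le)
  qed
  from this[of "length xs - 1"] show ?thesis
    using xs by (simp add: last_conv_nth)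
qed (use start in simp)

lemma prob_distribution_exists_pos:
  assumes "prob_distribution p"
  obtains i where "0 < p $ i"
  using assms unfolding prob_distribution_def
  by (metis less_le sum.neutral zero_neq_one)

text \<open>A state of zero mass has no outflow, so stationarity forbids any inflow from a state of
  positive mass.\<close>

lemma steady_state_pos:
  assumes Q: "transition_rate_matrix Q" "irreducible_rates Q" and \<mu>: "steady_state Q \<mu>"
  shows "0 < \<mu> $ i"
proof -
  have nonneg: "0 \<le> \<mu> $ j" for j
    using \<mu> by (simp add: steady_state_def prob_distribution_def)
  obtain k where k: "0 < \<mu> $ k"
    using \<mu> prob_distribution_exists_pos by (auto simp: steady_state_def)
  show ?thesis
    using Q k
  proof (rule irreducible_rates_induct)
    fix j k assume jk: "j \<noteq> k" "0 < Q $ j $ k" "0 < \<mu> $ j"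
    show "0 < \<mu> $ k"
    proof (rule ccontr)
      assume "\<not> 0 < \<mu> $ k"
      then have "\<mu> $ k = 0" using nonneg[of k] by simp
      have "0 < \<mu> $ j * Q $ j $ k" using jk by simp
      also have "\<dots> \<le> (\<Sum>l\<in>UNIV - {k}. \<mu> $ l * Q $ l $ k)"
        using jk nonneg Q(1)
        by (intro member_le_sum[of j _ "\<lambda>l. \<mu> $ l * Q $ l $ k"]) (auto simp: transition_rate_matrix_def)
      also have "\<dots> = (\<mu> v* Q) $ k"
        using \<open>\<mu> $ k = 0\<close> by (simp add: vector_matrix_mult_nth sum.remove[of UNIV k])
      also have "\<dots> = 0" using \<mu> by (simp add: steady_state_def)
      finally show False by simp
    qed
  qed
qed

section \<open>Solutions of the master equation\<close>

lemma solves_master_equation_component: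
  assumes "solves_master_equation Q p" "0 \<le> t"
  shows "((\<lambda>s. p s $ i) has_real_derivative (p t v* Q) $ i) (at t within {0..})"
  using assms bounded_linear.has_vector_derivative[OF bounded_linear_vec_nth, of p "p t v* Q"]
  by (simp add: solves_master_equation_def has_real_derivative_iff_has_vector_derivative)

text \<open>Supplies what the monotonicity theorems ask for: two-sided derivatives in the interior
  and continuity up to the endpoint \<open>0\<close>.\<close>

lemma half_line_derivative:
  fixes f :: "real \<Rightarrow> real"
  assumes "\<And>t. 0 \<le> t \<Longrightarrow> (f has_real_derivative f' t) (at t within {0..})"
  shows half_line_derivative_at: "\<And>t. 0 < t \<Longrightarrow> (f has_real_derivative f' t) (at t)"
    and half_line_derivative_continuous: "\<And>a b. 0 \<le> a \<Longrightarrow> continuous_on {a..b} f"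
proof -
  fix t :: real assume "0 < t"
  then show "(f has_real_derivative f' t) (at t)"
    using assms[of t] at_within_interior[of t "{0..}"] by simp
next
  have "continuous_on {0..} f"
    using assms by (intro DERIV_continuous_on) auto
  then show "continuous_on {a..b} f" if "0 \<le> a" for a b
    using that by (auto elim: continuous_on_subset)
qed

lemma half_line_mono:
  fixes f :: "real \<Rightarrow> real"
  assumes "\<And>t. 0 \<le> t \<Longrightarrow> (f has_real_derivative f' t) (at t within {0..})"
    and "\<And>t. 0 < t \<Longrightarrow> 0 \<le> f' t" and "0 \<le> a" "a \<le> b"
  shows "f a \<le> f b"
proof (rule DERIV_nonneg_imp_increasing_open[OF \<open>a \<le> b\<close>])
  fix t assume "a < t"
  then have "0 < t" using \<open>0 \<le> a\<close> by simp
  then show "\<exists>d. (f has_real_derivative d) (at t) \<and> 0 \<le> d"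
    using half_line_derivative_at[OF assms(1)] assms(2) by blast
qed (rule half_line_derivative_continuous[OF assms(1) \<open>0 \<le> a\<close>])

text \<open>Total mass is conserved because the rows of \<open>Q\<close> sum to zero.\<close>

lemma solves_master_equation_sum:
  assumes Q: "transition_rate_matrix Q" and p: "solves_master_equation Q p"
    and "prob_distribution (p 0)" "0 \<le> t"
  shows "(\<Sum>i\<in>UNIV. p t $ i) = 1"
proof -
  have "(\<Sum>i\<in>UNIV. (v v* Q) $ i) = 0" for v
  proof -
    have "(\<Sum>i\<in>UNIV. (v v* Q) $ i) = (\<Sum>j\<in>UNIV. v $ j * (\<Sum>i\<in>UNIV. Q $ j $ i))"
      unfolding vector_matrix_mult_nth sum_distrib_left by (rule sum.swap)
    then show ?thesis
      by (simp add: transition_rate_matrix_row_sum[OF Q])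
  qed
  then have "((\<lambda>s. \<Sum>i\<in>UNIV. p s $ i) has_real_derivative 0) (at s within {0..})" if "0 \<le> s" for s
    using DERIV_sum[of UNIV "\<lambda>s i. p s $ i", OF solves_master_equation_component[OF p that]] by simp
  then obtain c where "\<And>s. 0 \<le> s \<Longrightarrow> (\<Sum>i\<in>UNIV. p s $ i) = c"
    using has_field_derivative_zero_constant[of "{0..}" "\<lambda>s. \<Sum>i\<in>UNIV. p s $ i"] by auto
  then show ?thesis
    using assms(3) \<open>0 \<le> t\<close> by (metis order_refl prob_distribution_def)
qed

text \<open>Gronwall's argument for the squared norm \<open>V\<close> of the negative part: \<open>V' \<le> C V\<close> and \<open>V 0 = 0\<close>.\<close>

lemma solves_master_equation_nonneg:
  assumes Q: "transition_rate_matrix Q" and p: "solves_master_equation Q p"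
    and "prob_distribution (p 0)" "0 \<le> t"
  shows "0 \<le> p t $ i"
proof -
  define n where "n s i = min (p s $ i) 0" for s i
  define V where "V s = (\<Sum>i\<in>UNIV. (n s i)\<^sup>2)" for s
  define V' where "V' s = (\<Sum>i\<in>UNIV. 2 * n s i * (p s v* Q) $ i)" for s
  define K where "K = (\<Sum>i\<in>UNIV. \<Sum>j\<in>UNIV. \<bar>Q $ j $ i\<bar>)"
  define C where "C = 2 * K"
  have V_deriv: "(V has_real_derivative V' s) (at s within {0..})" if "0 \<le> s" for s
    unfolding V_def V'_def n_def
    by (intro DERIV_sum DERIV_chain2[OF has_real_derivative_min_0_square]
        solves_master_equation_component[OF p that])
  have V'_le: "V' s \<le> C * V s" for s
  proof -
    have "n s i * (p s $ j * Q $ j $ i) \<le> \<bar>Q $ j $ i\<bar> * V s" for i j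
    proof -
      \<comment> \<open>Off the diagonal the rate is nonnegative and \<open>n s i \<le> 0\<close>,
        so lowering \<open>p s $ j\<close> to its negative part can only raise the product. On the
        diagonal both sides agree.\<close>
      have "n s i * (p s $ j * Q $ j $ i) \<le> n s i * n s j * Q $ j $ i"
      proof (cases "i = j")
        case True
        then show ?thesis by (simp add: n_def min_def)
      next
        case False
        then have "0 \<le> Q $ j $ i" using Q by (simp add: transition_rate_matrix_def)
        then have "n s j * Q $ j $ i \<le> p s $ j * Q $ j $ i"
          by (intro mult_right_mono) (simp_all add: n_def)
        then show ?thesis
          using mult_left_mono_neg[of "n s j * Q $ j $ i" "p s $ j * Q $ j $ i" "n s i"]
          by (simp add: n_def mult.assoc)
      qed
      also have "\<dots> \<le> \<bar>Q $ j $ i\<bar> * (\<bar>n s i\<bar> * \<bar>n s j\<bar>)"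
        by (metis abs_ge_self abs_mult mult.commute)
      also have "\<bar>n s i\<bar> * \<bar>n s j\<bar> \<le> V s"
      proof -
        have le: "(n s k)\<^sup>2 \<le> V s" for k
          unfolding V_def by (intro member_le_sum[of k UNIV "\<lambda>i. (n s i)\<^sup>2"]) auto
        have "2 * (\<bar>n s i\<bar> * \<bar>n s j\<bar>) \<le> (n s i)\<^sup>2 + (n s j)\<^sup>2"
          using sum_squares_bound[of "\<bar>n s i\<bar>" "\<bar>n s j\<bar>"] by simp
        then show ?thesis using le[of i] le[of j] by linarith
      qed
      finally show ?thesis by (simp add: mult_left_mono)
    qed
    then have "(\<Sum>i\<in>UNIV. \<Sum>j\<in>UNIV. n s i * (p s $ j * Q $ j $ i)) \<le> K * V s"
      unfolding K_def sum_distrib_right by (intro sum_mono)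
    then show ?thesis
      by (simp add: V'_def C_def vector_matrix_mult_nth sum_distrib_left mult.assoc)
        (simp add: sum_distrib_left [symmetric])
  qed
  \<comment> \<open>\<open>exp (- C * s) * V s\<close> is nonincreasing; the minus sign fits it to
    \<open>half_line_mono\<close>.\<close>
  have "- (exp (- C * 0) * V 0) \<le> - (exp (- C * t) * V t)"
  proof (rule half_line_mono[of "\<lambda>s. - (exp (- C * s) * V s)" "\<lambda>s. exp (- C * s) * (C * V s - V' s)"])
    show "((\<lambda>s. - (exp (- C * s) * V s)) has_real_derivative exp (- C * s) * (C * V s - V' s))
        (at s within {0..})" if "0 \<le> s" for s
      using V_deriv[OF that] by (auto intro!: derivative_eq_intros simp: algebra_simps)
  qed (use V'_le \<open>0 \<le> t\<close> in auto)
  moreover have "V 0 = 0"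
  proof -
    have "n 0 i = 0" for i
      using assms(3) by (simp add: n_def prob_distribution_def)
    then show ?thesis by (simp add: V_def)
  qed
  ultimately have "V t \<le> 0"
    by (simp add: mult_le_0_iff)
  moreover have "(n t i)\<^sup>2 \<le> V t"
    unfolding V_def by (intro member_le_sum[of i UNIV "\<lambda>i. (n t i)\<^sup>2"]) auto
  ultimately have "(n t i)\<^sup>2 \<le> 0" by linarith
  then show ?thesis
    by (simp add: n_def min_def split: if_splits)
qed

text \<open>The integrating factor \<open>exp (- Q $ i $ i * s)\<close> removes the loss term, so
  the derivative of \<open>r i\<close> is pure inflow. Hence positivity persists in time and spreads
  along positive rates.\<close>

lemma solves_master_equation_pos:
  assumes Q: "transition_rate_matrix Q" "irreducible_rates Q" and p: "solves_master_equation Q p"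
    and p0: "prob_distribution (p 0)" and "0 < t"
  shows "0 < p t $ i"
proof -
  note nonneg = solves_master_equation_nonneg[OF Q(1) p p0]
  define r where "r i s = exp (- Q $ i $ i * s) * p s $ i" for i s
  define r' where "r' i s = exp (- Q $ i $ i * s) * (\<Sum>j\<in>UNIV - {i}. p s $ j * Q $ j $ i)" for i s
  have r_deriv: "(r i has_real_derivative r' i s) (at s within {0..})" if "0 \<le> s" for i s
    unfolding r_def r'_def using solves_master_equation_component[OF p that, of i]
    by (auto intro!: derivative_eq_intros
        simp: vector_matrix_mult_nth sum.remove[of UNIV i "\<lambda>j. p s $ j * Q $ j $ i"] algebra_simps)
  have off: "0 \<le> Q $ j $ i" if "j \<in> UNIV - {i}" for i j
    using that Q(1) by (simp add: transition_rate_matrix_def)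
  have r'_nonneg: "0 \<le> r' i s" if "0 \<le> s" for i s
    unfolding r'_def using nonneg[OF that] off by (intro mult_nonneg_nonneg sum_nonneg) auto
  obtain k where k: "0 < p 0 $ k"
    using prob_distribution_exists_pos[OF p0] .
  \<comment> \<open>The property passed along the path quantifies over all positive times, since
    each step needs inflow throughout \<open>(0, t)\<close>.\<close>
  have "\<forall>t>0. 0 < p t $ i"
    using Q
  proof (rule irreducible_rates_induct)
    have "r k 0 \<le> r k t" if "0 < t" for t
      by (rule half_line_mono[OF r_deriv r'_nonneg]) (use that in auto)
    moreover have "0 < r k 0" using k by (simp add: r_def)
    ultimately have "0 < r k t" if "0 < t" for t
      using that by (meson less_le_trans)
    then show "\<forall>t>0. 0 < p t $ k"
      by (simp add: r_def zero_less_mult_iff)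
  next
    fix j k assume jk: "j \<noteq> k" "0 < Q $ j $ k" and j: "\<forall>t>0. 0 < p t $ j"
    show "\<forall>t>0. 0 < p t $ k"
    proof (intro allI impI)
      fix t :: real assume "0 < t"
      \<comment> \<open>Inflow from \<open>j\<close> makes \<open>r k\<close> rise strictly, even if
        it starts at \<open>0\<close>.\<close>
      have "r k 0 < r k t"
        using \<open>0 < t\<close>
      proof (rule DERIV_pos_imp_increasing_open)
        fix s :: real assume "0 < s"
        have "0 < p s $ j * Q $ j $ k" using j jk \<open>0 < s\<close> by simp
        also have "\<dots> \<le> (\<Sum>l\<in>UNIV - {k}. p s $ l * Q $ l $ k)"
          using jk nonneg[of s] \<open>0 < s\<close> off
          by (intro member_le_sum[of j _ "\<lambda>l. p s $ l * Q $ l $ k"]) auto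
        finally show "\<exists>d. (r k has_real_derivative d) (at s) \<and> 0 < d"
          using half_line_derivative_at[OF r_deriv \<open>0 < s\<close>, of k] by (auto simp: r'_def)
      qed (use half_line_derivative_continuous[OF r_deriv] in blast)
      moreover have "0 \<le> r k 0" using nonneg[of 0 k] by (simp add: r_def)
      ultimately have "0 < r k t" by linarith
      then show "0 < p t $ k" by (simp add: r_def zero_less_mult_iff)
    qed
  qed
  then show ?thesis using \<open>0 < t\<close> by blast
qed

section \<open>Dissipation of the free energy\<close>

text \<open>The terms \<open>f (x j)\<close> cancel by the zero row sums, the terms depending on \<open>x i\<close> alone by
  stationarity. The diagonal terms, where \<open>Q $ i $ i\<close> is negative, vanish on the right.\<close>

lemma stationary_bregman_sum:
  fixes Q :: "real ^ 'n ^ 'n" and x :: "'n \<Rightarrow> real"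
  assumes "transition_rate_matrix Q" "\<mu> v* Q = 0"
  shows "(\<Sum>i\<in>UNIV. g (x i) * (\<Sum>j\<in>UNIV. \<mu> $ j * x j * Q $ j $ i))
    = - (\<Sum>i\<in>UNIV. \<Sum>j\<in>UNIV - {i}. \<mu> $ j * Q $ j $ i * (f (x j) - f (x i) - g (x i) * (x j - x i)))"
proof -
  have col: "(\<Sum>j\<in>UNIV. \<mu> $ j * Q $ j $ i) = 0" for i
    using assms(2) vector_matrix_mult_nth[of \<mu> Q i] by simp
  have f1: "(\<Sum>i\<in>UNIV. \<Sum>j\<in>UNIV. \<mu> $ j * Q $ j $ i * f (x j)) = 0"
  proof -
    have "(\<Sum>i\<in>UNIV. \<Sum>j\<in>UNIV. \<mu> $ j * Q $ j $ i * f (x j))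
        = (\<Sum>j\<in>UNIV. \<mu> $ j * f (x j) * (\<Sum>i\<in>UNIV. Q $ j $ i))"
      by (subst sum.swap) (simp add: sum_distrib_left mult.assoc mult.left_commute mult.commute)
    then show ?thesis by (simp add: transition_rate_matrix_row_sum[OF assms(1)])
  qed
  have f2: "(\<Sum>j\<in>UNIV. \<mu> $ j * Q $ j $ i * c) = 0" for i c
    using col[of i] by (simp add: sum_distrib_right [symmetric])
  have "(\<Sum>i\<in>UNIV. \<Sum>j\<in>UNIV - {i}. \<mu> $ j * Q $ j $ i * (f (x j) - f (x i) - g (x i) * (x j - x i)))
      = (\<Sum>i\<in>UNIV. \<Sum>j\<in>UNIV. \<mu> $ j * Q $ j $ i * (f (x j) - f (x i) - g (x i) * (x j - x i)))"
    by (intro sum.cong refl sum.mono_neutral_left) auto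
  also have "\<dots> = (\<Sum>i\<in>UNIV. \<Sum>j\<in>UNIV. \<mu> $ j * Q $ j $ i * f (x j)
      + \<mu> $ j * Q $ j $ i * (g (x i) * x i - f (x i)) - g (x i) * (\<mu> $ j * x j * Q $ j $ i))"
    by (intro sum.cong refl) (simp add: algebra_simps)
  also have "\<dots> = - (\<Sum>i\<in>UNIV. g (x i) * (\<Sum>j\<in>UNIV. \<mu> $ j * x j * Q $ j $ i))"
    by (simp add: sum.distrib sum_subtractf f1 f2 sum_distrib_left)
  finally show ?thesis by simp
qed

lemma tsallis_free_energy_derivative:
  assumes p: "solves_master_equation Q p" and "0 \<le> t" and pos: "\<And>i. 0 < p t $ i"
    and \<mu>: "\<And>i. 0 < \<mu> $ i" and "\<alpha> \<noteq> 0" "\<alpha> \<noteq> 1"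
  shows "((\<lambda>s. tsallis_free_energy \<alpha> \<mu> (p s)) has_real_derivative
    (\<Sum>i\<in>UNIV. (p t $ i / \<mu> $ i) powr (\<alpha> - 1) / (\<alpha> - 1) * (p t v* Q) $ i)) (at t within {0..})"
proof -
  \<comment> \<open>The function is \<open>m * (x / m) powr \<alpha>\<close>; the factor
    \<open>\<alpha>\<close> in its derivative cancels against the prefactor of the free
    energy.\<close>
  have F: "((\<lambda>x. x * (x / m) powr (\<alpha> - 1)) has_real_derivative \<alpha> * (x / m) powr (\<alpha> - 1)) (at x)"
    if "0 < x" "0 < m" for x m :: real
  proof -
    have "x / m * (x / m) powr (\<alpha> - 2) = (x / m) powr (\<alpha> - 1)"
      using powr_mult_base[of "x / m" "\<alpha> - 2"] that by simp
    then have "x * (x / m) powr (\<alpha> - 2) / m = (x / m) powr (\<alpha> - 1)"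
      by simp
    then show ?thesis
      using that by (auto intro!: derivative_eq_intros simp: algebra_simps)
        (simp add: mult.assoc flip: times_divide_eq_right)
  qed
  have "((\<lambda>s. \<Sum>i\<in>UNIV. p s $ i * (p s $ i / \<mu> $ i) powr (\<alpha> - 1)) has_real_derivative
      (\<Sum>i\<in>UNIV. \<alpha> * (p t $ i / \<mu> $ i) powr (\<alpha> - 1) * (p t v* Q) $ i)) (at t within {0..})"
    using DERIV_chain2[OF F[OF pos \<mu>] solves_master_equation_component[OF p \<open>0 \<le> t\<close>]]
    by (intro DERIV_sum)
  then have "((\<lambda>s. tsallis_free_energy \<alpha> \<mu> (p s)) has_real_derivative
      1 / (\<alpha> * (\<alpha> - 1)) * ((\<Sum>i\<in>UNIV. \<alpha> * (p t $ i / \<mu> $ i) powr (\<alpha> - 1) * (p t v* Q) $ i) - 0))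
      (at t within {0..})"
    unfolding tsallis_free_energy_def by (intro DERIV_cmult DERIV_diff DERIV_const)
  moreover have "1 / (\<alpha> * (\<alpha> - 1)) * ((\<Sum>i\<in>UNIV. \<alpha> * (p t $ i / \<mu> $ i) powr (\<alpha> - 1) * (p t v* Q) $ i) - 0)
      = (\<Sum>i\<in>UNIV. (p t $ i / \<mu> $ i) powr (\<alpha> - 1) / (\<alpha> - 1) * (p t v* Q) $ i)"
    using assms(5,6) by (simp add: sum_distrib_left)
  ultimately show ?thesis by simp
qed

theorem theorem3p18:
  fixes Q :: "real ^ 'n ^ 'n" and \<mu> :: "real ^ 'n" and \<alpha> :: real
  assumes "transition_rate_matrix Q"
    and "irreducible_rates Q"
    and "steady_state Q \<mu>"
    and "\<alpha> \<noteq> 0" and "\<alpha> \<noteq> 1"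
  shows "\<exists>c>0. \<forall>p. solves_master_equation Q p \<and> prob_distribution (p 0) \<longrightarrow>
     (\<forall>t>0. \<forall>i. 0 < p t $ i) \<and>
     (\<forall>t\<ge>0. (\<forall>i. 0 < p t $ i) \<longrightarrow>
        (\<exists>D. ((\<lambda>s. tsallis_free_energy \<alpha> \<mu> (p s)) has_real_derivative D) (at t within {0..}) \<and>
             - D \<ge> (if \<alpha> < 2
                      then c * (\<Sum>i\<in>UNIV. (net_flux Q (p t) i)\<^sup>2)
                      else c * (\<Sum>i\<in>UNIV. \<bar>net_flux Q (p t) i\<bar> powr \<alpha>))))"
proof -
  note Q = assms(1,2)
  have \<mu>_pos: "0 < \<mu> $ i" for i
    using steady_state_pos[OF Q assms(3)] .
  \<comment> \<open>One exponent for both cases: for \<open>\<alpha> < 2\<close> the power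
    \<open>\<bar>y\<bar> powr 2\<close> is the square.\<close>
  define \<beta> where "\<beta> = (if \<alpha> < 2 then 2 else \<alpha>)"
  \<comment> \<open>Unit total mass gives \<open>p t $ i \<le> 1\<close>, so \<open>M\<close> bounds
    every ratio \<open>p t $ i / \<mu> $ i\<close> uniformly in the solution and in time.\<close>
  define M where "M = (\<Sum>i\<in>UNIV. 1 / \<mu> $ i)"
  define k where "k = (if \<alpha> < 2 then M powr (\<alpha> - 2) / 2 else 1 / (\<alpha> * (\<alpha> - 1)))"
  \<comment> \<open>The summand \<open>1\<close> keeps \<open>W\<close>, and hence the divisor
    \<open>E\<close>, positive even when all rates vanish, as for a single state.\<close>
  define W where "W = 1 + (\<Sum>i\<in>UNIV. \<Sum>j\<in>UNIV. \<bar>\<mu> $ j * Q $ j $ i\<bar>)"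
  define E where "E = real CARD('n) powr \<beta> * W powr (\<beta> - 1)"
  define \<phi> where "\<phi> x = x powr \<alpha> / (\<alpha> * (\<alpha> - 1))" for x
  define \<psi> where "\<psi> x = x powr (\<alpha> - 1) / (\<alpha> - 1)" for x
  have M_pos: "0 < M"
    unfolding M_def using \<mu>_pos by (intro sum_pos) auto
  then have k_pos: "0 < k"
    by (simp add: k_def)
  have "1 \<le> \<beta>" by (simp add: \<beta>_def)
  have "0 < W"
    unfolding W_def by (intro add_pos_nonneg sum_nonneg) auto
  then have E_pos: "0 < E"
    by (simp add: E_def)
  have w_le: "\<mu> $ j * Q $ j $ i \<le> W" for i j
  proof -
    have "\<mu> $ j * Q $ j $ i \<le> \<bar>\<mu> $ j * Q $ j $ i\<bar>" by simp
    also have "\<dots> \<le> (\<Sum>j\<in>UNIV. \<bar>\<mu> $ j * Q $ j $ i\<bar>)"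
      by (intro member_le_sum[of j UNIV "\<lambda>j. \<bar>\<mu> $ j * Q $ j $ i\<bar>"]) auto
    also have "\<dots> \<le> (\<Sum>i\<in>UNIV. \<Sum>j\<in>UNIV. \<bar>\<mu> $ j * Q $ j $ i\<bar>)"
      by (intro member_le_sum[of i UNIV "\<lambda>i. \<Sum>j\<in>UNIV. \<bar>\<mu> $ j * Q $ j $ i\<bar>"]) (auto intro: sum_nonneg)
    finally show ?thesis by (simp add: W_def)
  qed
  have w_nonneg: "0 \<le> \<mu> $ j * Q $ j $ i" if "j \<in> UNIV - {i}" for i j
    using that Q(1) \<mu>_pos[of j] by (simp add: transition_rate_matrix_def)
  have bregman: "k * \<bar>y - x\<bar> powr \<beta> \<le> \<phi> y - \<phi> x - \<psi> x * (y - x)"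
    if "0 < x" "x \<le> M" "0 < y" "y \<le> M" for x y
    using powr_bregman_ge_square[of \<alpha> x M y] powr_bregman_ge_powr[of \<alpha> x y] that assms(4,5)
    by (simp add: k_def \<beta>_def \<phi>_def \<psi>_def)
  show ?thesis
  \<comment> \<open>\<open>k\<close> comes from the Bregman bound and \<open>E\<close> from the flux
    bound; neither depends on the solution or on time.\<close>
  proof (rule exI[of _ "k / E"], intro conjI allI impI)
    show "0 < k / E" using k_pos E_pos by simp
  next
    fix p t i assume "solves_master_equation Q p \<and> prob_distribution (p 0)" "0 < (t :: real)"
    then show "0 < p t $ i" using solves_master_equation_pos[OF Q] by blast
  next
    fix p and t :: real
    assume p: "solves_master_equation Q p \<and> prob_distribution (p 0)" and "0 \<le> t"
      and pos: "\<forall>i. 0 < p t $ i"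
    define x where "x i = p t $ i / \<mu> $ i" for i
    define B where "B i j = \<phi> (x j) - \<phi> (x i) - \<psi> (x i) * (x j - x i)" for i j
    define D where "D = (\<Sum>i\<in>UNIV. \<psi> (x i) * (p t v* Q) $ i)"
    have px: "p t $ i = \<mu> $ i * x i" for i
      using \<mu>_pos[of i] by (simp add: x_def)
    have x_bounds: "0 < x i \<and> x i \<le> M" for i
    proof
      show "0 < x i" using pos \<mu>_pos by (simp add: x_def)
      have "p t $ i \<le> (\<Sum>i\<in>UNIV. p t $ i)"
        using pos by (intro member_le_sum[of i UNIV "\<lambda>i. p t $ i"]) (auto intro: less_imp_le)
      also have "\<dots> = 1"
        using solves_master_equation_sum[OF Q(1)] p \<open>0 \<le> t\<close> by blast
      finally have "x i \<le> 1 / \<mu> $ i"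
        using \<mu>_pos[of i] by (simp add: x_def divide_right_mono)
      also have "\<dots> \<le> M"
        unfolding M_def using \<mu>_pos
        by (intro member_le_sum[of i UNIV "\<lambda>i. 1 / \<mu> $ i"]) (auto intro: less_imp_le)
      finally show "x i \<le> M" .
    qed
    have D_deriv: "((\<lambda>s. tsallis_free_energy \<alpha> \<mu> (p s)) has_real_derivative D) (at t within {0..})"
      unfolding D_def \<psi>_def x_def
      using p pos \<mu>_pos assms(4,5) \<open>0 \<le> t\<close> by (intro tsallis_free_energy_derivative) auto
    have \<mu>_stat: "\<mu> v* Q = 0" using assms(3) by (simp add: steady_state_def)
    have D_eq: "- D = (\<Sum>i\<in>UNIV. \<Sum>j\<in>UNIV - {i}. \<mu> $ j * Q $ j $ i * B i j)"
      using stationary_bregman_sum[OF Q(1) \<mu>_stat, of \<psi> x \<phi>]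
      by (simp add: D_def B_def vector_matrix_mult_nth px)
    \<comment> \<open>Stationarity permits subtracting \<open>x i\<close> times the zero column sum
      of \<open>\<mu> $ j * Q $ j $ i\<close>, which turns the flux into a sum of
      differences.\<close>
    have flux: "net_flux Q (p t) i = (\<Sum>j\<in>UNIV - {i}. \<mu> $ j * Q $ j $ i * (x j - x i))" for i
    proof -
      have "(\<Sum>j\<in>UNIV - {i}. \<mu> $ j * Q $ j $ i * (x j - x i))
          = (\<Sum>j\<in>UNIV. \<mu> $ j * Q $ j $ i * (x j - x i))"
        by (intro sum.mono_neutral_left) auto
      also have "\<dots> = (p t v* Q) $ i - (\<mu> v* Q) $ i * x i"
        by (simp add: vector_matrix_mult_nth px algebra_simps sum_subtractf sum_distrib_left)
      also have "\<dots> = net_flux Q (p t) i"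
        using \<mu>_stat by (simp add: net_flux_eq[OF Q(1)])
      finally show ?thesis by simp
    qed
    have "\<bar>net_flux Q (p t) i\<bar> powr \<beta> \<le> E * (\<Sum>j\<in>UNIV - {i}. \<mu> $ j * Q $ j $ i * \<bar>x j - x i\<bar> powr \<beta>)" for i
    proof -
      \<comment> \<open>The cardinality is then enlarged to that of all states, so that the single
        constant \<open>E\<close> serves every \<open>i\<close>.\<close>
      have "\<bar>net_flux Q (p t) i\<bar> powr \<beta> \<le> real (card (UNIV - {i} :: 'n set)) powr \<beta> * W powr (\<beta> - 1)
          * (\<Sum>j\<in>UNIV - {i}. \<mu> $ j * Q $ j $ i * \<bar>x j - x i\<bar> powr \<beta>)"
        unfolding flux using w_nonneg w_le \<open>1 \<le> \<beta>\<close> \<open>0 < W\<close> by (intro weighted_sum_powr_le) auto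
      also have "\<dots> \<le> E * (\<Sum>j\<in>UNIV - {i}. \<mu> $ j * Q $ j $ i * \<bar>x j - x i\<bar> powr \<beta>)"
        unfolding E_def using w_nonneg \<open>1 \<le> \<beta>\<close>
        by (intro mult_right_mono powr_mono2 sum_nonneg mult_nonneg_nonneg[of "_ * _"]) auto
      finally show ?thesis .
    qed
    then have "k / E * (\<Sum>i\<in>UNIV. \<bar>net_flux Q (p t) i\<bar> powr \<beta>)
        \<le> k / E * (\<Sum>i\<in>UNIV. E * (\<Sum>j\<in>UNIV - {i}. \<mu> $ j * Q $ j $ i * \<bar>x j - x i\<bar> powr \<beta>))"
      using k_pos E_pos by (intro mult_left_mono sum_mono) auto
    also have "\<dots> = (\<Sum>i\<in>UNIV. \<Sum>j\<in>UNIV - {i}. \<mu> $ j * Q $ j $ i * (k * \<bar>x j - x i\<bar> powr \<beta>))"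
      using E_pos by (simp add: sum_distrib_left mult.left_commute)
    also have "\<dots> \<le> - D"
      unfolding D_eq B_def using bregman x_bounds w_nonneg by (intro sum_mono mult_left_mono) auto
    finally have "k / E * (\<Sum>i\<in>UNIV. \<bar>net_flux Q (p t) i\<bar> powr \<beta>) \<le> - D" .
    then have "- D \<ge> (if \<alpha> < 2 then k / E * (\<Sum>i\<in>UNIV. (net_flux Q (p t) i)\<^sup>2)
        else k / E * (\<Sum>i\<in>UNIV. \<bar>net_flux Q (p t) i\<bar> powr \<alpha>))"
      by (simp add: \<beta>_def split: if_splits)
    with D_deriv show "\<exists>D. ((\<lambda>s. tsallis_free_energy \<alpha> \<mu> (p s)) has_real_derivative D) (at t within {0..}) \<and>
        - D \<ge> (if \<alpha> < 2 then k / E * (\<Sum>i\<in>UNIV. (net_flux Q (p t) i)\<^sup>2)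
          else k / E * (\<Sum>i\<in>UNIV. \<bar>net_flux Q (p t) i\<bar> powr \<alpha>))"
      by blast
  qed
qed

end
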